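(* For any connected hypergraph $H$ with root (sink) vertex $q$, there exists a bijection between the set of $H$-parking functions and the set of $q$-rooted spanning trees of $H$.
   Context: A hypergraph $H=(V,E)$ consists of a finite vertex set $V$ and a set $E$ of nonempty subsets of $V$, called hyperedges. $H$ is connected if for any two vertices $v_1,v_2$ there is a sequence of hyperedges $(e_1,\dots,e_m)$ with $v_1\in e_1$, $v_2\in e_m$ and $e_i\cap e_{i+1}\neq\emptyset$ for $i=1,\dots,m-1$. One vertex $q\in V$ is fixed as the sink (root), and the other vertices are identified with $[n]=\{1,\dots,n\}$. For nonempty $T\subseteq V$ and $v\in T$, set $\deg_T(v)=|\{e\in E: v\in e \text{ and } e\not\subseteq T\}|$. An $H$-parking function is a vector $\vec{c}\in\mathbb{Z}_{\ge 0}^n$ such that for every nonempty $T\subseteq[n]$ there is $i\in T$ with $c_i<\deg_T(i)$. The bipartite incidence graph $B(H)$ has vertex set $L\sqcup R$ with $L=E$, $R=V$, and an edge between $e\in E$ and $v\in V$ whenever $v\in e$. Two spanning trees $T,T'$ of the graph $B(H)$ are burning equivalent if, after orienting the edges of $T$ and of $T'$ towards the sink $q\in R$, the set of edges directed from $R$ to $L$ is the same for $T$ and for $T'$. A $q$-rooted spanning tree of $H$ is, by definition, a burning equivalence class $[T]$ of spanning trees of $B(H)$. *)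

theory Defs
  imports Main "HOL-Library.FuncSet"
begin

section \<open>Hypergraphs and parking functions\<close>

definition hypergraph :: "'a set \<Rightarrow> 'a set set \<Rightarrow> bool" where
  "hypergraph V E \<longleftrightarrow> finite V \<and> (\<forall>e\<in>E. e \<subseteq> V \<and> e \<noteq> {})"

text \<open>
  The two vertices are taken to be distinct, so that the hypergraph with one
  vertex and no hyperedges counts as connected.
\<close>
definition connected_hypergraph :: "'a set \<Rightarrow> 'a set set \<Rightarrow> bool" where
  "connected_hypergraph V E \<longleftrightarrow>
     (\<forall>v1\<in>V. \<forall>v2\<in>V. v1 \<noteq> v2 \<longrightarrow>
        (\<exists>es. es \<noteq> [] \<and> set es \<subseteq> E \<and> v1 \<in> hd es \<and> v2 \<in> last es
            \<and> successively (\<lambda>e f. e \<inter> f \<noteq> {}) es))"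

definition hdeg :: "'a set set \<Rightarrow> 'a set \<Rightarrow> 'a \<Rightarrow> nat" where
  "hdeg E T v = card {e \<in> E. v \<in> e \<and> \<not> e \<subseteq> T}"

text \<open>
  Vectors indexed by the non-sink vertices are functions on \<open>V - {q}\<close>,
  extended by \<open>undefined\<close> outside, so that equal vectors are equal functions.
\<close>
definition parking_functions :: "'a set \<Rightarrow> 'a set set \<Rightarrow> 'a \<Rightarrow> ('a \<Rightarrow> nat) set" where
  "parking_functions V E q =
     {c \<in> (V - {q}) \<rightarrow>\<^sub>E UNIV.
        \<forall>T. T \<subseteq> V - {q} \<and> T \<noteq> {} \<longrightarrow> (\<exists>i\<in>T. c i < hdeg E T i)}"

section \<open>Undirected graphs\<close>

text \<open>
  A simple graph is given by its vertex set \<open>W\<close> and its set \<open>F\<close> of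
  two-element edges. Walks, paths and cycles are lists of vertices.
\<close>

definition walk :: "'b set \<Rightarrow> 'b set set \<Rightarrow> 'b list \<Rightarrow> bool" where
  "walk W F xs \<longleftrightarrow> xs \<noteq> [] \<and> set xs \<subseteq> W \<and> successively (\<lambda>x y. {x, y} \<in> F) xs"

definition path :: "'b set \<Rightarrow> 'b set set \<Rightarrow> 'b list \<Rightarrow> bool" where
  "path W F xs \<longleftrightarrow> walk W F xs \<and> distinct xs"

text \<open>The list of vertices of a cycle does not repeat its starting point.\<close>
definition cycle :: "'b set \<Rightarrow> 'b set set \<Rightarrow> 'b list \<Rightarrow> bool" where
  "cycle W F xs \<longleftrightarrow> path W F xs \<and> length xs \<ge> 3 \<and> {last xs, hd xs} \<in> F"

definition connected_graph :: "'b set \<Rightarrow> 'b set set \<Rightarrow> bool" where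
  "connected_graph W F \<longleftrightarrow>
     W \<noteq> {} \<and> (\<forall>x\<in>W. \<forall>y\<in>W. \<exists>xs. walk W F xs \<and> hd xs = x \<and> last xs = y)"

definition tree :: "'b set \<Rightarrow> 'b set set \<Rightarrow> bool" where
  "tree W F \<longleftrightarrow> connected_graph W F \<and> (\<nexists>xs. cycle W F xs)"

text \<open>A spanning tree has the same vertex set as the graph, so its edge set determines it.\<close>
definition spanning_trees :: "'b set \<Rightarrow> 'b set set \<Rightarrow> 'b set set set" where
  "spanning_trees W F = {T. T \<subseteq> F \<and> tree W T}"

text \<open>
  In a tree, an edge between \<open>x\<close> and \<open>y\<close> is oriented towards the root \<open>r\<close> as
  \<open>(x, y)\<close> if it is the first edge of the path from \<open>x\<close> to \<open>r\<close>.
\<close>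
definition orient_towards :: "'b set \<Rightarrow> 'b set set \<Rightarrow> 'b \<Rightarrow> ('b \<times> 'b) set" where
  "orient_towards W T r = {(x, y). \<exists>xs. path W T (x # y # xs) \<and> last (y # xs) = r}"

section \<open>The incidence graph and rooted spanning trees of a hypergraph\<close>

text \<open>The hyperedges (left side) are tagged by \<open>Inl\<close>, the vertices (right side) by \<open>Inr\<close>.\<close>

definition inc_verts :: "'a set \<Rightarrow> 'a set set \<Rightarrow> ('a set + 'a) set" where
  "inc_verts V E = E <+> V"

definition inc_edges :: "'a set \<Rightarrow> 'a set set \<Rightarrow> ('a set + 'a) set set" where
  "inc_edges V E = {{Inl e, Inr v} | e v. e \<in> E \<and> v \<in> V \<and> v \<in> e}"

definition inc_spanning_trees :: "'a set \<Rightarrow> 'a set set \<Rightarrow> ('a set + 'a) set set set" where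
  "inc_spanning_trees V E = spanning_trees (inc_verts V E) (inc_edges V E)"

definition right_to_left ::
  "'a set \<Rightarrow> 'a set set \<Rightarrow> 'a \<Rightarrow> ('a set + 'a) set set \<Rightarrow> ('a \<times> 'a set) set" where
  "right_to_left V E q T =
     {(v, e). (Inr v, Inl e) \<in> orient_towards (inc_verts V E) T (Inr q)}"

definition burning_equiv ::
  "'a set \<Rightarrow> 'a set set \<Rightarrow> 'a \<Rightarrow> ('a set + 'a) set set rel" where
  "burning_equiv V E q =
     {(T, T'). T \<in> inc_spanning_trees V E \<and> T' \<in> inc_spanning_trees V E
        \<and> right_to_left V E q T = right_to_left V E q T'}"

lemma equiv_burning_equiv: "equiv (inc_spanning_trees V E) (burning_equiv V E q)"
  by (rule equivI) (auto simp: burning_equiv_def refl_on_def sym_def trans_def)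

definition rooted_spanning_trees ::
  "'a set \<Rightarrow> 'a set set \<Rightarrow> 'a \<Rightarrow> ('a set + 'a) set set set set" where
  "rooted_spanning_trees V E q = inc_spanning_trees V E // burning_equiv V E q"

end

theory Submission
  imports Defs
begin

text \<open>
  Both sides of the theorem are instances of one kind of object. Write \<open>X = V - {q}\<close>, and let
  every \<open>T \<subseteq> X\<close> and \<open>v \<in> X\<close> come with a set \<open>A T v\<close> of values that lets fire spread to \<open>v\<close> when
  the vertices outside \<open>T\<close> are on fire. A function \<open>h\<close> on \<open>X\<close> is burning if no nonempty \<open>T\<close> resists,
  that is, if every such \<open>T\<close> has a vertex \<open>v\<close> with \<open>h v \<in> A T v\<close>.

  The parking functions are the burning functions for \<open>A T v = {..<hdeg E T v}\<close>. The rooted spanning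
  trees are the burning functions for \<open>A T v = {e \<in> E. v \<in> e \<and> \<not> e \<subseteq> T}\<close>. Indeed, a burning class is
  determined by the function \<open>h\<close> that sends each \<open>v \<noteq> q\<close> to the first hyperedge on its path to the
  sink. If \<open>h v \<subseteq> T\<close> held for all \<open>v\<close> in a nonempty \<open>T\<close>, the tree paths from \<open>T\<close> could never leave \<open>T\<close>
  and so never reach \<open>q\<close>. Conversely, a burning \<open>h\<close> lets a fire started at \<open>q\<close> reach every vertex,
  and a tree with first steps \<open>h\<close> arises when each hyperedge is attached to its vertex that burns
  earliest (\<open>bij_betw_burning_functions_rooted_spanning_trees\<close>).

  The two families have the same cardinalities, since \<open>hdeg E T v\<close> counts exactly the hyperedges in
  the second set. The remaining point is \<open>card_burning_functions_cong\<close>: when \<open>A T v\<close> shrinks as \<open>T\<close>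
  grows, the number of burning functions depends only on the numbers \<open>card (A T v)\<close>. To see this,
  classify all functions in \<open>PiE X (A {})\<close> by the set \<open>T\<close> that the fire leaves unburnt. Such a function
  is a free choice of values outside \<open>A T v\<close> for \<open>v \<in> T\<close>, together with a burning function on the
  smaller set \<open>X - T\<close>. The total and, by induction on \<open>X\<close>, the terms with \<open>T \<noteq> {}\<close> are determined by
  the cardinalities. Hence so is the term with \<open>T = {}\<close>, which counts the burning functions.
\<close>

section \<open>Functions that burn a set\<close>

definition burning_functions :: "'a set \<Rightarrow> ('a set \<Rightarrow> 'a \<Rightarrow> 'b set) \<Rightarrow> ('a \<Rightarrow> 'b) set" where
  "burning_functions X A =
     {h \<in> PiE X (A {}). \<forall>T. T \<subseteq> X \<and> T \<noteq> {} \<longrightarrow> (\<exists>v\<in>T. h v \<in> A T v)}"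

text \<open>
  The union of all resisting sets. For families that shrink as \<open>T\<close> grows it is itself resisting,
  hence it is the set left over when the fire stops.
\<close>
definition unburnt :: "'a set \<Rightarrow> ('a set \<Rightarrow> 'a \<Rightarrow> 'b set) \<Rightarrow> ('a \<Rightarrow> 'b) \<Rightarrow> 'a set" where
  "unburnt X A h = \<Union>{T. T \<subseteq> X \<and> (\<forall>v\<in>T. h v \<notin> A T v)}"

lemma burning_functions_PiE: "h \<in> burning_functions X A \<Longrightarrow> h \<in> PiE X (A {})"
  by (simp add: burning_functions_def)

lemma burning_functions_burn:
  assumes "h \<in> burning_functions X A" and "T \<subseteq> X" and "T \<noteq> {}"
  shows "\<exists>v\<in>T. h v \<in> A T v"
  using assms unfolding burning_functions_def by blast

lemma unburnt_subset: "unburnt X A h \<subseteq> X"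
  by (auto simp: unburnt_def)

lemma subset_unburnt:
  assumes "T \<subseteq> X" and "\<And>v. v \<in> T \<Longrightarrow> h v \<notin> A T v"
  shows "T \<subseteq> unburnt X A h"
  using assms by (auto simp: unburnt_def)

text \<open>
  A value that a resisting set \<open>T\<close> excludes stays excluded for every larger set, so resisting sets
  are closed under union.
\<close>
lemma unburnt_avoids:
  assumes mono: "\<And>S T v. S \<subseteq> T \<Longrightarrow> T \<subseteq> X \<Longrightarrow> A T v \<subseteq> A S v"
    and "v \<in> unburnt X A h"
  shows "h v \<notin> A (unburnt X A h) v"
proof -
  obtain T where T: "T \<subseteq> X" "\<forall>v\<in>T. h v \<notin> A T v" "v \<in> T"
    using assms(2) by (auto simp: unburnt_def)
  have "T \<subseteq> unburnt X A h"
    using T by (intro subset_unburnt) auto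
  then have "A (unburnt X A h) v \<subseteq> A T v"
    by (rule mono[OF _ unburnt_subset])
  then show ?thesis using T by auto
qed

text \<open>
  Once the fire stops at \<open>T\<close>, the values on \<open>T\<close> are only constrained to lie outside \<open>A T v\<close>. On
  \<open>X - T\<close>, a set \<open>S\<close> that resists relative to \<open>S \<union> T\<close> could be added to \<open>T\<close>. By maximality there is
  none, which is burning for the family shifted by \<open>T\<close>.
\<close>
lemma bij_betw_split_at_unburnt:
  fixes A :: "'a set \<Rightarrow> 'a \<Rightarrow> 'b set"
  assumes mono: "\<And>S T v. S \<subseteq> T \<Longrightarrow> T \<subseteq> X \<Longrightarrow> A T v \<subseteq> A S v"
    and "T \<subseteq> X"
  shows "bij_betw (\<lambda>h. (restrict h T, restrict h (X - T)))
           {h \<in> PiE X (A {}). unburnt X A h = T}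
           (PiE T (\<lambda>v. A {} v - A T v) \<times> burning_functions (X - T) (\<lambda>S. A (S \<union> T)))"
    (is "bij_betw ?split ?D (?C1 \<times> ?C2)")
proof (rule bij_betw_byWitness[where f' = "\<lambda>(f, g) v. if v \<in> T then f v else g v"])
  show "\<forall>h\<in>?D. (\<lambda>(f, g) v. if v \<in> T then f v else g v) (?split h) = h"
  proof (rule ballI)
    fix h assume "h \<in> ?D"
    then have "h v = undefined" if "v \<notin> X" for v
      using that by (auto elim: PiE_arb)
    then show "(\<lambda>(f, g) v. if v \<in> T then f v else g v) (?split h) = h"
      by (simp add: fun_eq_iff)
  qed
  show "\<forall>p\<in>?C1 \<times> ?C2. ?split ((\<lambda>(f, g) v. if v \<in> T then f v else g v) p) = p"
  proof (rule ballI)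
    fix p assume "p \<in> ?C1 \<times> ?C2"
    then obtain f g where p: "p = (f, g)" and f: "f \<in> extensional T" and g: "g \<in> extensional (X - T)"
      by (auto simp: PiE_def burning_functions_def)
    then show "?split ((\<lambda>(f, g) v. if v \<in> T then f v else g v) p) = p"
      by (auto simp: p fun_eq_iff extensional_arb[OF f] extensional_arb[OF g])
  qed
  show "?split ` ?D \<subseteq> ?C1 \<times> ?C2"
  proof (rule image_subsetI)
    fix h assume "h \<in> ?D"
    then have h: "h \<in> PiE X (A {})" "unburnt X A h = T" by auto
    have avoid: "h v \<notin> A T v" if "v \<in> T" for v
      using unburnt_avoids[of X A, OF mono] that h(2) by blast
    have burn: "\<exists>v\<in>S. h v \<in> A (S \<union> T) v" if S: "S \<subseteq> X - T" "S \<noteq> {}" for S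
    proof (rule ccontr)
      assume no: "\<not> (\<exists>v\<in>S. h v \<in> A (S \<union> T) v)"
      have "S \<union> T \<subseteq> X" using S \<open>T \<subseteq> X\<close> by auto
      then have "A (S \<union> T) v \<subseteq> A T v" for v
        by (intro mono) auto
      then have "h v \<notin> A (S \<union> T) v" if "v \<in> S \<union> T" for v
        using that no avoid by auto
      then have "S \<union> T \<subseteq> unburnt X A h"
        using \<open>S \<union> T \<subseteq> X\<close> by (intro subset_unburnt) auto
      then show False using S h(2) by auto
    qed
    \<comment> \<open>The shifted family at the empty set is \<open>A T\<close>, so the values must lie there and not just in \<open>A {} v\<close>.\<close>
    have "h v \<in> A T v" if "v \<in> X - T" for v
    proof -
      have "h v \<in> A ({v} \<union> T) v" using burn[of "{v}"] that by auto
      moreover have "A ({v} \<union> T) v \<subseteq> A T v"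
        using that \<open>T \<subseteq> X\<close> by (intro mono) auto
      ultimately show ?thesis by auto
    qed
    moreover have "\<exists>v\<in>S. restrict h (X - T) v \<in> A (S \<union> T) v" if S: "S \<subseteq> X - T" "S \<noteq> {}" for S
      using burn[OF S] S(1) by (metis restrict_apply' subsetD)
    ultimately have "restrict h (X - T) \<in> ?C2"
      unfolding burning_functions_def by simp
    moreover have "restrict h T \<in> ?C1"
      using h(1) avoid \<open>T \<subseteq> X\<close> by auto
    ultimately show "?split h \<in> ?C1 \<times> ?C2" by simp
  qed
  show "(\<lambda>(f, g) v. if v \<in> T then f v else g v) ` (?C1 \<times> ?C2) \<subseteq> ?D"
  proof (rule image_subsetI)
    fix p assume "p \<in> ?C1 \<times> ?C2"
    then obtain f g where p: "p = (f, g)" and f: "f \<in> ?C1" and g: "g \<in> ?C2" by blast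
    define h where "h = (\<lambda>v. if v \<in> T then f v else g v)"
    have sub: "A T v \<subseteq> A {} v" for v
      using \<open>T \<subseteq> X\<close> by (intro mono) auto
    have g': "g \<in> PiE (X - T) (A T)"
      using burning_functions_PiE[OF g] by simp
    have "h \<in> PiE X (A {})"
    proof (rule PiE_I)
      show "h v \<in> A {} v" if "v \<in> X" for v
        using PiE_mem[OF f, of v] PiE_mem[OF g', of v] sub[of v] that by (auto simp: h_def)
      show "h v = undefined" if "v \<notin> X" for v
        using PiE_arb[OF g', of v] that \<open>T \<subseteq> X\<close> by (auto simp: h_def)
    qed
    moreover have "T \<subseteq> unburnt X A h"
    proof (rule subset_unburnt[OF \<open>T \<subseteq> X\<close>])
      fix v assume "v \<in> T"
      then show "h v \<notin> A T v" using PiE_mem[OF f, of v] by (simp add: h_def)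
    qed
    moreover have "unburnt X A h - T = {}"
    proof (rule ccontr)
      let ?S = "unburnt X A h - T"
      assume "?S \<noteq> {}"
      moreover have "?S \<subseteq> X - T" using unburnt_subset[of X A h] by auto
      ultimately obtain v where v: "v \<in> ?S" "g v \<in> A (?S \<union> T) v"
        using burning_functions_burn[OF g, of ?S] by blast
      moreover have "?S \<union> T = unburnt X A h"
        using \<open>T \<subseteq> unburnt X A h\<close> by auto
      ultimately have "h v \<in> A (unburnt X A h) v" by (simp add: h_def)
      then show False using unburnt_avoids[of X A v h, OF mono] v by auto
    qed
    ultimately show "(\<lambda>(f, g) v. if v \<in> T then f v else g v) p \<in> ?D"
      unfolding p h_def by auto
  qed
qed

lemma prod_card_eq_sum_unburnt:
  fixes A :: "'a set \<Rightarrow> 'a \<Rightarrow> 'b set"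
  assumes mono: "\<And>S T v. S \<subseteq> T \<Longrightarrow> T \<subseteq> X \<Longrightarrow> A T v \<subseteq> A S v"
    and "finite X" and fin: "\<And>v. v \<in> X \<Longrightarrow> finite (A {} v)"
  shows "(\<Prod>v\<in>X. card (A {} v)) =
    (\<Sum>T\<in>Pow X. (\<Prod>v\<in>T. card (A {} v) - card (A T v))
                  * card (burning_functions (X - T) (\<lambda>S. A (S \<union> T))))"
proof -
  let ?D = "\<lambda>T. {h \<in> PiE X (A {}). unburnt X A h = T}"
  have "(\<Prod>v\<in>X. card (A {} v)) = card (PiE X (A {}))"
    using \<open>finite X\<close> by (simp add: card_PiE)
  also have "PiE X (A {}) = (\<Union>T\<in>Pow X. ?D T)"
    using unburnt_subset[of X A] by auto
  also have "card \<dots> = (\<Sum>T\<in>Pow X. card (?D T))"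
  proof (rule card_UN_disjoint)
    have "finite (PiE X (A {}))" using \<open>finite X\<close> fin by (intro finite_PiE) auto
    then show "\<forall>T\<in>Pow X. finite (?D T)" by auto
  qed (use \<open>finite X\<close> in auto)
  also have "\<dots> = (\<Sum>T\<in>Pow X. (\<Prod>v\<in>T. card (A {} v) - card (A T v))
                  * card (burning_functions (X - T) (\<lambda>S. A (S \<union> T))))"
  proof (rule sum.cong[OF refl])
    fix T assume "T \<in> Pow X"
    then have T: "T \<subseteq> X" by simp
    then have "finite T" using \<open>finite X\<close> finite_subset by blast
    have diff: "card (A {} v - A T v) = card (A {} v) - card (A T v)" if "v \<in> T" for v
    proof -
      have "A T v \<subseteq> A {} v" using T by (intro mono) auto
      then show ?thesis using fin[of v] that T finite_subset by (intro card_Diff_subset) blast+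
    qed
    show "card (?D T) = (\<Prod>v\<in>T. card (A {} v) - card (A T v))
                  * card (burning_functions (X - T) (\<lambda>S. A (S \<union> T)))"
      using bij_betw_same_card[OF bij_betw_split_at_unburnt[of X A, OF mono T]] \<open>finite T\<close> diff
      by (simp add: card_cartesian_product card_PiE)
  qed
  finally show ?thesis .
qed

text \<open>
  In \<open>prod_card_eq_sum_unburnt\<close> the term for \<open>T = {}\<close> is the number of burning functions on \<open>X\<close>, and all other terms concern
  proper subsets of \<open>X\<close>. This gives an induction without an explicit bijection.
\<close>
lemma card_burning_functions_cong:
  fixes A :: "'a set \<Rightarrow> 'a \<Rightarrow> 'b set" and B :: "'a set \<Rightarrow> 'a \<Rightarrow> 'c set"
  assumes "finite X"
    and "\<And>S T v. S \<subseteq> T \<Longrightarrow> T \<subseteq> X \<Longrightarrow> A T v \<subseteq> A S v"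
    and "\<And>S T v. S \<subseteq> T \<Longrightarrow> T \<subseteq> X \<Longrightarrow> B T v \<subseteq> B S v"
    and "\<And>v. v \<in> X \<Longrightarrow> finite (A {} v)"
    and "\<And>v. v \<in> X \<Longrightarrow> finite (B {} v)"
    and "\<And>T v. T \<subseteq> X \<Longrightarrow> v \<in> X \<Longrightarrow> card (A T v) = card (B T v)"
  shows "card (burning_functions X A) = card (burning_functions X B)"
  using assms
proof (induction "card X" arbitrary: X A B rule: less_induct)
  case less
  note monoA = less.prems(2) and monoB = less.prems(3)
  define sA where "sA T = (\<Prod>v\<in>T. card (A {} v) - card (A T v))
     * card (burning_functions (X - T) (\<lambda>S. A (S \<union> T)))" for T
  define sB where "sB T = (\<Prod>v\<in>T. card (B {} v) - card (B T v))
     * card (burning_functions (X - T) (\<lambda>S. B (S \<union> T)))" for T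
  have eq: "sA T = sB T" if "T \<in> Pow X - {{}}" for T
  proof -
    have T: "T \<subseteq> X" "T \<noteq> {}" using that by auto
    have "card (burning_functions (X - T) (\<lambda>S. A (S \<union> T))) =
          card (burning_functions (X - T) (\<lambda>S. B (S \<union> T)))"
    proof (rule less.hyps)
      show "card (X - T) < card X"
        using T less.prems(1) by (intro psubset_card_mono) auto
      show "A (S' \<union> T) v \<subseteq> A (S \<union> T) v" if "S \<subseteq> S'" "S' \<subseteq> X - T" for S S' v
        using that T by (intro monoA) auto
      show "B (S' \<union> T) v \<subseteq> B (S \<union> T) v" if "S \<subseteq> S'" "S' \<subseteq> X - T" for S S' v
        using that T by (intro monoB) auto
      show "finite (A ({} \<union> T) v)" if "v \<in> X - T" for v
        using that T monoA[of "{}" T v] less.prems(4)[of v] by (auto intro: finite_subset)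
      show "finite (B ({} \<union> T) v)" if "v \<in> X - T" for v
        using that T monoB[of "{}" T v] less.prems(5)[of v] by (auto intro: finite_subset)
      show "card (A (S \<union> T) v) = card (B (S \<union> T) v)" if "S \<subseteq> X - T" "v \<in> X - T" for S v
        using that T by (intro less.prems(6)) auto
    qed (use less.prems(1) in auto)
    moreover have "(\<Prod>v\<in>T. card (A {} v) - card (A T v)) = (\<Prod>v\<in>T. card (B {} v) - card (B T v))"
    proof (rule prod.cong[OF refl])
      fix v assume "v \<in> T"
      then have "v \<in> X" using T by auto
      then show "card (A {} v) - card (A T v) = card (B {} v) - card (B T v)"
        using T less.prems(6)[of T v] less.prems(6)[of "{}" v] by simp
    qed
    ultimately show ?thesis by (simp add: sA_def sB_def)
  qed
  have "sum sA (Pow X) = (\<Prod>v\<in>X. card (A {} v))"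
    unfolding sA_def using prod_card_eq_sum_unburnt[of X A, OF monoA] less.prems by simp
  also have "\<dots> = (\<Prod>v\<in>X. card (B {} v))"
    using less.prems(6) by (intro prod.cong) auto
  also have "\<dots> = sum sB (Pow X)"
    unfolding sB_def using prod_card_eq_sum_unburnt[of X B, OF monoB] less.prems by simp
  finally have "sA {} + sum sA (Pow X - {{}}) = sB {} + sum sB (Pow X - {{}})"
    using less.prems(1) by (simp add: sum.remove[of "Pow X" "{}"])
  moreover have "sum sA (Pow X - {{}}) = sum sB (Pow X - {{}})"
    using eq by (intro sum.cong) auto
  ultimately show ?case by (simp add: sA_def sB_def)
qed

section \<open>Trees oriented towards a root\<close>

lemma walk_join:
  assumes "walk W F (xs @ [a])" and "walk W F (a # ys)"
  shows "walk W F (xs @ a # ys)"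
  using assms by (auto simp: walk_def successively_append_iff)

lemma walk_appendD:
  assumes "walk W F (xs @ ys)"
  shows "xs \<noteq> [] \<Longrightarrow> walk W F xs" and "ys \<noteq> [] \<Longrightarrow> walk W F ys"
  using assms by (auto simp: walk_def successively_append_iff)

lemma walk_rev: "walk W F xs \<Longrightarrow> walk W F (rev xs)"
  by (simp add: walk_def insert_commute)

lemma walk_Cons:
  "walk W F (x # y # ys) \<longleftrightarrow> x \<in> W \<and> {x, y} \<in> F \<and> walk W F (y # ys)"
  by (auto simp: walk_def)

text \<open>Cutting out the part between two visits to the same vertex shortens the walk.\<close>
lemma walk_imp_path:
  assumes "walk W F xs"
  shows "\<exists>ys. path W F ys \<and> hd ys = hd xs \<and> last ys = last xs"
  using assms
proof (induction "length xs" arbitrary: xs rule: less_induct)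
  case less
  show ?case
  proof (cases "distinct xs")
    case True
    then show ?thesis using less.prems by (auto simp: path_def)
  next
    case False
    then obtain as bs cs a where xs: "xs = as @ [a] @ bs @ [a] @ cs"
      using not_distinct_decomp by blast
    have "walk W F ((as @ [a]) @ bs @ a # cs)" "walk W F ((as @ a # bs) @ a # cs)"
      using less.prems by (simp_all add: xs)
    then have "walk W F (as @ [a])" "walk W F (a # cs)"
      using walk_appendD by blast+
    then have "walk W F (as @ [a] @ cs)"
      using walk_join by fastforce
    from less.hyps[OF _ this] show ?thesis
      by (auto simp: xs hd_append)
  qed
qed

lemma walks_with_common_end:
  assumes xs: "walk W F xs" and ys: "walk W F ys" and "last xs = last ys"
  shows "\<exists>ws. walk W F ws \<and> hd ws = hd xs \<and> last ws = hd ys"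
proof -
  have ne: "xs \<noteq> []" "ys \<noteq> []" using xs ys by (auto simp: walk_def)
  define zs where "zs = tl (rev ys)"
  have rev: "rev ys = last xs # zs"
    using ne assms(3) by (cases "rev ys") (auto simp: zs_def hd_rev[symmetric])
  have "walk W F (butlast xs @ [last xs])" using xs ne by simp
  moreover have "walk W F (last xs # zs)" using walk_rev[OF ys] by (simp add: rev)
  ultimately have "walk W F (butlast xs @ last xs # zs)" by (rule walk_join)
  moreover have "butlast xs @ last xs # zs = xs @ zs" using ne
    by (metis append_Cons append_Nil append_assoc append_butlast_last_id)
  moreover have "last (xs @ zs) = hd ys"
    using rev ne by (metis append_is_Nil_conv last_append last_rev last.simps)
  ultimately show ?thesis using ne by (metis hd_append)
qed

text \<open>
  Both paths avoid \<open>x\<close> after their first step. If those steps differed, then following one path to the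
  common end and the other one back would join \<open>y\<close> to \<open>z\<close> outside \<open>x\<close>, and \<open>x\<close> would close a cycle.
\<close>
lemma tree_first_step_unique:
  assumes "tree W F" and p: "path W F (x # y # ys)" and p': "path W F (x # z # zs)"
    and "last (y # ys) = last (z # zs)"
  shows "y = z"
proof (rule ccontr)
  assume "y \<noteq> z"
  have yr: "walk (W - {x}) F (y # ys)" and zr: "walk (W - {x}) F (z # zs)"
    using p p' by (auto simp: path_def walk_def)
  obtain ws where ws: "walk (W - {x}) F ws" "hd ws = y" "last ws = z"
    using walks_with_common_end[OF yr zr assms(4)] by auto
  obtain ps where ps: "path (W - {x}) F ps" "hd ps = y" "last ps = z"
    using walk_imp_path[OF ws(1)] ws(2,3) by auto
  then obtain p2 ps' where ps': "ps = y # p2 # ps'"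
    using ps \<open>y \<noteq> z\<close> by (cases ps; cases "tl ps") (auto simp: path_def walk_def)
  have "cycle W F (x # ps)"
    using p p' ps ps' unfolding cycle_def path_def
    by (auto simp: walk_def insert_commute)
  then show False using \<open>tree W F\<close> by (auto simp: tree_def)
qed

lemma orient_towardsI:
  "path W F (x # y # xs) \<Longrightarrow> last (y # xs) = r \<Longrightarrow> (x, y) \<in> orient_towards W F r"
  unfolding orient_towards_def by blast

lemma orient_towards_edge:
  assumes "(x, y) \<in> orient_towards W F r"
  shows "x \<in> W - {r}" and "{x, y} \<in> F"
proof -
  obtain xs where xs: "path W F (x # y # xs)" "last (y # xs) = r"
    using assms by (auto simp: orient_towards_def)
  then show "{x, y} \<in> F" by (simp add: path_def walk_def)
  have "r \<in> set (y # xs)" using xs(2) last_in_set by blast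
  then show "x \<in> W - {r}" using xs(1) by (auto simp: path_def walk_def)
qed

lemma orient_towards_unique:
  assumes "tree W F" and "(x, y) \<in> orient_towards W F r" and "(x, z) \<in> orient_towards W F r"
  shows "y = z"
  using assms tree_first_step_unique unfolding orient_towards_def by fastforce

lemma orient_towards_exists:
  assumes "tree W F" and "x \<in> W - {r}" and "r \<in> W"
  shows "\<exists>y. (x, y) \<in> orient_towards W F r"
proof -
  obtain xs where "walk W F xs" "hd xs = x" "last xs = r"
    using assms unfolding tree_def connected_graph_def by blast
  then obtain ys where ys: "path W F ys" "hd ys = x" "last ys = r"
    using walk_imp_path by metis
  moreover obtain y zs where "ys = x # y # zs"
    using ys assms(2) by (cases ys; cases "tl ys") (auto simp: path_def walk_def)
  ultimately have "path W F (x # y # zs)" "last (y # zs) = r" by simp_all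
  then show ?thesis by (blast intro: orient_towardsI)
qed

text \<open>
  Trees are built from a parent map. The rank strictly decreases towards the root, which rules out
  cycles and guarantees that the root is reached.
\<close>
locale ranked_parents =
  fixes W :: "'b set" and r :: 'b and par :: "'b \<Rightarrow> 'b" and rank :: "'b \<Rightarrow> nat"
  assumes root: "r \<in> W"
    and par_in: "x \<in> W - {r} \<Longrightarrow> par x \<in> W"
    and rank_par: "x \<in> W - {r} \<Longrightarrow> rank (par x) < rank x"
begin

definition parent_edges :: "'b set set" where
  "parent_edges = {{x, par x} | x. x \<in> W - {r}}"

text \<open>
  The bound on ranks makes the induction work: it shows that \<open>x\<close> does not occur again on the path of
  its parent.
\<close>
lemma ex_descending_path:
  assumes "x \<in> W"
  shows "\<exists>xs. path W parent_edges (x # xs) \<and> last (x # xs) = r \<and> (\<forall>y\<in>set xs. rank y < rank x)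
           \<and> (x \<noteq> r \<longrightarrow> xs \<noteq> [] \<and> hd xs = par x)"
  using assms
proof (induction "rank x" arbitrary: x rule: less_induct)
  case less
  show ?case
  proof (cases "x = r")
    case True
    then show ?thesis using less.prems by (intro exI[of _ "[]"]) (auto simp: path_def walk_def)
  next
    case False
    then have x: "x \<in> W - {r}" using less.prems by auto
    from less.hyps[OF rank_par[OF x] par_in[OF x]] obtain ys where
      ys: "path W parent_edges (par x # ys)" "last (par x # ys) = r" "\<forall>y\<in>set ys. rank y < rank (par x)"
      by blast
    have "{x, par x} \<in> parent_edges" using x by (auto simp: parent_edges_def)
    moreover have "\<forall>y\<in>set (par x # ys). rank y < rank x"
      using ys(3) rank_par[OF x] by auto
    ultimately show ?thesis
      using ys x by (intro exI[of _ "par x # ys"]) (auto simp: path_def walk_Cons)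
  qed
qed

text \<open>
  On a cycle, a vertex of maximal rank would have its parent as both neighbours, but the two
  neighbours on a cycle are distinct.
\<close>
lemma tree_parent_edges: "tree W parent_edges"
  unfolding tree_def connected_graph_def
proof (intro conjI ballI)
  show "W \<noteq> {}" using root by auto
next
  fix x y assume "x \<in> W" "y \<in> W"
  then obtain xs ys where xs: "walk W parent_edges (x # xs)" "last (x # xs) = r"
    and ys: "walk W parent_edges (y # ys)" "last (y # ys) = r"
    using ex_descending_path unfolding path_def by metis
  then show "\<exists>xs. walk W parent_edges xs \<and> hd xs = x \<and> last xs = y"
    using walks_with_common_end[OF xs(1) ys(1)] by simp
next
  show "\<nexists>xs. cycle W parent_edges xs"
  proof
    assume "\<exists>xs. cycle W parent_edges xs"
    then obtain xs where xs: "walk W parent_edges xs" "distinct xs" "length xs \<ge> 3" "{last xs, hd xs} \<in> parent_edges"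
      by (auto simp: cycle_def path_def)
    define n where "n = length xs"
    have n: "n \<ge> 3" using xs(3) by (simp add: n_def)
    then have "xs \<noteq> []" by (auto simp: n_def)
    have edge: "{xs ! i, xs ! (Suc i mod n)} \<in> parent_edges" if "i < n" for i
    proof (cases "Suc i = n")
      case True
      then have "i = length xs - 1" "Suc i mod n = 0" by (auto simp: n_def)
      then have "xs ! i = last xs" "xs ! (Suc i mod n) = hd xs"
        using \<open>xs \<noteq> []\<close> by (simp_all add: last_conv_nth hd_conv_nth)
      then show ?thesis using xs(4) by simp
    next
      case False
      then show ?thesis using xs(1) that
        by (auto simp: n_def walk_def successively_conv_nth)
    qed
    obtain x where x: "x \<in> set xs" "\<forall>y\<in>set xs. rank y \<le> rank x"
    proof -
      have "Max (rank ` set xs) \<in> rank ` set xs" using \<open>xs \<noteq> []\<close> by (intro Max_in) auto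
      then obtain x where "x \<in> set xs" "rank x = Max (rank ` set xs)" by auto
      then show ?thesis by (intro that[of x]) auto
    qed
    have up: "y = par x" if "y \<in> set xs" "{x, y} \<in> parent_edges" for y
      using that x(2) rank_par by (fastforce simp: parent_edges_def doubleton_eq_iff)
    obtain i where i: "i < n" "xs ! i = x"
      using x(1) by (auto simp: n_def in_set_conv_nth)
    define j where "j = (if i = 0 then n - 1 else i - 1)"
    define k where "k = Suc i mod n"
    have j: "j < n" "Suc j mod n = i" using i n by (auto simp: j_def)
    have k: "k < n" using n by (simp add: k_def)
    have "j \<noteq> k"
    proof (cases "Suc i = n")
      case True
      then show ?thesis using n by (auto simp: j_def k_def)
    next
      case False
      then show ?thesis using n i(1) by (auto simp: j_def k_def)
    qed
    moreover have "xs ! j = par x"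
      using edge[OF j(1)] j i up by (metis insert_commute n_def nth_mem)
    moreover have "xs ! k = par x"
      using edge[OF i(1)] i(2) k up unfolding k_def by (metis n_def nth_mem)
    ultimately show False
      using xs(2) j(1) k by (metis n_def nth_eq_iff_index_eq)
  qed
qed

lemma orient_towards_parent_edges: "orient_towards W parent_edges r = {(x, par x) | x. x \<in> W - {r}}"
proof -
  have *: "(x, par x) \<in> orient_towards W parent_edges r" if x: "x \<in> W - {r}" for x
  proof -
    obtain xs where xs: "path W parent_edges (x # xs)" "last (x # xs) = r" "xs \<noteq> []" "hd xs = par x"
      using ex_descending_path[of x] x by blast
    then obtain ys where "xs = par x # ys" by (cases xs) auto
    with xs show ?thesis by (intro orient_towardsI[of W parent_edges x "par x" ys]) simp_all
  qed
  moreover have "x \<in> W - {r} \<and> y = par x" if "(x, y) \<in> orient_towards W parent_edges r" for x y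
    using orient_towards_unique[OF tree_parent_edges that *] orient_towards_edge(1)[OF that] by blast
  ultimately show ?thesis by (intro set_eqI) auto
qed

end

section \<open>Burning classes as choices of hyperedges\<close>

lemma inc_verts_iff [simp]:
  "Inl e \<in> inc_verts V E \<longleftrightarrow> e \<in> E"
  "Inr v \<in> inc_verts V E \<longleftrightarrow> v \<in> V"
  by (auto simp: inc_verts_def)

abbreviation crossing :: "'a set set \<Rightarrow> 'a set \<Rightarrow> 'a \<Rightarrow> 'a set set" where
  "crossing E T v \<equiv> {e \<in> E. v \<in> e \<and> \<not> e \<subseteq> T}"

text \<open>
  The function \<open>h\<close> takes each vertex to the next node on its path to the sink. It is burning because
  the path alternates between a vertex \<open>v\<close>, the hyperedge \<open>h v\<close> and a vertex of \<open>h v\<close>, so it cannot leave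
  a set that contains \<open>h v\<close> for each of its vertices \<open>v\<close>.
\<close>
lemma burning_function_of_spanning_tree:
  assumes "q \<in> V" and T: "T \<in> inc_spanning_trees V E"
  shows "\<exists>h\<in>burning_functions (V - {q}) (crossing E).
           right_to_left V E q T = {(v, h v) | v. v \<in> V - {q}}"
proof -
  let ?W = "inc_verts V E"
  let ?O = "orient_towards ?W T (Inr q)"
  have tree: "tree ?W T" and sub: "T \<subseteq> inc_edges V E"
    using T by (auto simp: inc_spanning_trees_def spanning_trees_def)
  have root: "Inr q \<in> ?W" using \<open>q \<in> V\<close> by simp
  have out: "\<exists>e. y = Inl e \<and> e \<in> E \<and> v \<in> e" if "{Inr v, y} \<in> T" for v y
    using that sub by (auto simp: inc_edges_def doubleton_eq_iff)
  have "\<exists>e. (Inr v, Inl e) \<in> ?O" if "v \<in> V - {q}" for v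
  proof -
    have "Inr v \<in> ?W - {Inr q}" using that by auto
    from orient_towards_exists[OF tree this root] obtain y where y: "(Inr v, y) \<in> ?O" ..
    from out[OF orient_towards_edge(2)[OF this]] obtain e where "y = Inl e" by blast
    with y show ?thesis by blast
  qed
  then obtain h0 where h0: "\<And>v. v \<in> V - {q} \<Longrightarrow> (Inr v, Inl (h0 v)) \<in> ?O"
    by metis
  define h where "h = restrict h0 (V - {q})"
  have h: "(Inr v, Inl (h v)) \<in> ?O" if "v \<in> V - {q}" for v
    using h0 that by (simp add: h_def)
  have next_is_h: "e = h v" if "(Inr v, Inl e) \<in> ?O" "v \<in> V - {q}" for v e
    using orient_towards_unique[OF tree that(1) h[OF that(2)]] by simp
  have "v \<in> V - {q}" if "(Inr v, Inl e) \<in> ?O" for v e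
    using orient_towards_edge(1)[OF that] by auto
  then have rtl: "right_to_left V E q T = {(v, h v) | v. v \<in> V - {q}}"
    unfolding right_to_left_def using h next_is_h by blast
  have "h v \<in> crossing E {} v" if "v \<in> V - {q}" for v
    using out[OF orient_towards_edge(2)[OF h[OF that]]] by auto
  then have "h \<in> PiE (V - {q}) (crossing E {})" by (auto simp: h_def)
  moreover have "\<exists>v\<in>S. h v \<in> crossing E S v" if S: "S \<subseteq> V - {q}" "S \<noteq> {}" for S
  proof (rule ccontr)
    assume no: "\<not> (\<exists>v\<in>S. h v \<in> crossing E S v)"
    have inside: "h v \<subseteq> S" if "v \<in> S" for v
      using no that S out[OF orient_towards_edge(2)[OF h[of v]]] by auto
    have trapped: "v \<notin> S" if "path ?W T xs" "hd xs = Inr v" "last xs = Inr q" for v xs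
      using that
    proof (induction "length xs" arbitrary: v xs rule: less_induct)
      case less
      show ?case
      proof
        assume v: "v \<in> S"
        then have "v \<noteq> q" using S by auto
        then obtain y ys where xs: "xs = Inr v # y # ys"
          using less.prems by (cases xs; cases "tl xs") (auto simp: path_def walk_def)
        then have "(Inr v, y) \<in> ?O"
          using less.prems by (intro orient_towardsI[of ?W T "Inr v" y ys]) simp_all
        then obtain e where y: "y = Inl e" "e = h v"
          using out[OF orient_towards_edge(2)] next_is_h v S by (metis subsetD)
        then obtain z zs where ys: "ys = z # zs"
          using less.prems(3) xs by (cases ys) auto
        then have "{Inl e, z} \<in> T" using less.prems(1) xs y by (auto simp: path_def walk_def)
        then obtain u where u: "z = Inr u" "u \<in> e"
          using sub by (auto simp: inc_edges_def doubleton_eq_iff)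
        have "path ?W T (z # zs)" using less.prems(1) xs ys by (auto simp: path_def walk_def)
        then have "u \<notin> S"
          using less.hyps[of "z # zs" u] less.prems(3) xs ys u by auto
        then show False using u y inside[OF v] by auto
      qed
    qed
    obtain v where v: "v \<in> S" using S by auto
    then have "(Inr v, Inl (h v)) \<in> ?O" using h S by auto
    then obtain xs where "path ?W T (Inr v # Inl (h v) # xs)" "last (Inl (h v) # xs) = Inr q"
      by (auto simp: orient_towards_def)
    then show False using trapped[of "Inr v # Inl (h v) # xs" v] v by simp
  qed
  ultimately have "h \<in> burning_functions (V - {q}) (crossing E)"
    unfolding burning_functions_def by blast
  then show ?thesis using rtl by blast
qed

text \<open>
  Let fire spread from \<open>q\<close>, with \<open>v\<close> catching fire as soon as some vertex of \<open>h v\<close> burns. Since \<open>h\<close> is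
  burning, every vertex gets a burning time \<open>d v\<close>. Taking \<open>h v\<close> as the parent of \<open>v\<close>, and a vertex of
  \<open>e\<close> with least burning time as the parent of a hyperedge \<open>e\<close>, gives the required tree.
\<close>
lemma spanning_tree_of_burning_function:
  assumes hyp: "hypergraph V E" and "q \<in> V"
    and h: "h \<in> burning_functions (V - {q}) (crossing E)"
  shows "\<exists>T\<in>inc_spanning_trees V E. right_to_left V E q T = {(v, h v) | v. v \<in> V - {q}}"
proof -
  have hE: "h v \<in> E" "v \<in> h v" if "v \<in> V - {q}" for v
    using PiE_mem[OF burning_functions_PiE[OF h] that] by auto
  define R where "R = {(v, w). v \<in> V - {q} \<and> w \<in> h v}"
  \<comment> \<open>The vertices never reached by the fire form a resisting set, so there are none.\<close>
  define U where "U = {v \<in> V. \<forall>n. (v, q) \<notin> R ^^ n}"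
  have "U = {}"
  proof (rule ccontr)
    assume "U \<noteq> {}"
    moreover have "q \<notin> U"
      unfolding U_def by (auto intro!: exI[of _ 0])
    then have "U \<subseteq> V - {q}" by (auto simp: U_def)
    ultimately obtain v where v: "v \<in> U" "\<not> h v \<subseteq> U" "v \<in> V - {q}"
      using burning_functions_burn[OF h, of U] by auto
    then obtain w where w: "w \<in> h v" "w \<notin> U" by auto
    then have "w \<in> V" using hE[OF v(3)] hyp by (auto simp: hypergraph_def)
    then obtain n where "(w, q) \<in> R ^^ n" using w by (auto simp: U_def)
    then have "(v, q) \<in> R ^^ Suc n"
      using v w by (intro relpow_Suc_I2[of v w]) (auto simp: R_def)
    then show False using v by (auto simp: U_def simp del: relpow.simps)
  qed
  define d where "d v = (LEAST n. (v, q) \<in> R ^^ n)" for v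
  have d: "(v, q) \<in> R ^^ d v" if "v \<in> V" for v
    using that \<open>U = {}\<close> unfolding d_def U_def by (auto intro: LeastI)
  have d_step: "\<exists>w\<in>h v. d w < d v" if "v \<in> V - {q}" for v
  proof -
    have dv: "(v, q) \<in> R ^^ d v" and "v \<noteq> q" using d that by auto
    then obtain m where m: "d v = Suc m"
      by (cases "d v") auto
    from relpow_Suc_D2[OF dv[unfolded m]] obtain w where w: "(v, w) \<in> R" "(w, q) \<in> R ^^ m"
      by blast
    have "d w \<le> m" unfolding d_def using w(2) by (rule Least_le)
    moreover have "w \<in> h v" using w(1) by (simp add: R_def)
    ultimately show ?thesis using m by (intro bexI[of _ w]) simp_all
  qed
  define p where "p e = arg_min_on d e" for e
  have p: "p e \<in> e" "\<And>w. w \<in> e \<Longrightarrow> d (p e) \<le> d w" if "e \<in> E" for e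
  proof -
    have "finite e" "e \<noteq> {}"
      using that hyp finite_subset by (auto simp: hypergraph_def)
    then show "p e \<in> e" "\<And>w. w \<in> e \<Longrightarrow> d (p e) \<le> d w"
      unfolding p_def by (rule arg_min_if_finite(1), rule arg_min_least)
  qed
  define par where "par = case_sum (\<lambda>e. Inr (p e)) (\<lambda>v. Inl (h v))"
  \<comment> \<open>Doubling the burning times leaves room for a hyperedge between its parent and the vertices it ignites.\<close>
  define rank where "rank = case_sum (\<lambda>e. Suc (2 * d (p e))) (\<lambda>v. 2 * d v)"
  interpret ranked_parents "inc_verts V E" "Inr q" par rank
  proof
    show "Inr q \<in> inc_verts V E" using \<open>q \<in> V\<close> by simp
    fix x assume x: "x \<in> inc_verts V E - {Inr q}"
    show "par x \<in> inc_verts V E"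
    proof (cases x)
      case (Inl e)
      then have "e \<in> E" using x by auto
      then have "p e \<in> V" using p(1)[of e] hyp by (auto simp: hypergraph_def)
      then show ?thesis using Inl by (simp add: par_def)
    next
      case (Inr v)
      then show ?thesis using x hE(1)[of v] by (simp add: par_def)
    qed
    show "rank (par x) < rank x"
    proof (cases x)
      case (Inl e)
      then show ?thesis by (simp add: par_def rank_def)
    next
      case (Inr v)
      then have v: "v \<in> V - {q}" using x by auto
      obtain w where "w \<in> h v" "d w < d v" using d_step[OF v] by auto
      then have "d (p (h v)) < d v" using p(2)[OF hE(1)[OF v]] le_less_trans by blast
      then show ?thesis using Inr by (simp add: par_def rank_def)
    qed
  qed
  have "{x, par x} \<in> inc_edges V E" if "x \<in> inc_verts V E - {Inr q}" for x
  proof (cases x)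
    case (Inl e)
    then have "e \<in> E" using that by auto
    then have "p e \<in> e" "p e \<in> V" using p(1)[of e] hyp by (auto simp: hypergraph_def)
    then show ?thesis using \<open>e \<in> E\<close> Inl unfolding par_def inc_edges_def by auto
  next
    case (Inr v)
    then have "v \<in> V - {q}" using that by auto
    then show ?thesis using hE[of v] Inr unfolding par_def inc_edges_def
      by (auto simp: insert_commute)
  qed
  then have "parent_edges \<in> inc_spanning_trees V E"
    using tree_parent_edges
    unfolding parent_edges_def inc_spanning_trees_def spanning_trees_def by blast
  moreover have "right_to_left V E q parent_edges = {(v, h v) | v. v \<in> V - {q}}"
    unfolding right_to_left_def orient_towards_parent_edges by (auto simp: par_def)
  ultimately show ?thesis by blast
qed

text \<open>
  The burning class of a spanning tree is the fibre of \<open>right_to_left\<close> through it, and the values of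
  \<open>right_to_left\<close> are the graphs of burning functions.
\<close>
lemma bij_betw_burning_functions_rooted_spanning_trees:
  assumes "hypergraph V E" and "q \<in> V"
  shows "bij_betw
    (\<lambda>h. {T \<in> inc_spanning_trees V E. right_to_left V E q T = {(v, h v) | v. v \<in> V - {q}}})
    (burning_functions (V - {q}) (crossing E)) (rooted_spanning_trees V E q)"
    (is "bij_betw ?class ?H _")
proof (rule bij_betw_imageI)
  show "inj_on ?class ?H"
  proof (rule inj_onI)
    fix h h' assume h: "h \<in> ?H" "h' \<in> ?H" and eq: "?class h = ?class h'"
    obtain T where "T \<in> ?class h" using spanning_tree_of_burning_function[OF assms h(1)] by blast
    moreover from this have "T \<in> ?class h'" unfolding eq .
    ultimately have "{(v, h v) | v. v \<in> V - {q}} = {(v, h' v) | v. v \<in> V - {q}}"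
      by simp
    then have "h v = h' v" if "v \<in> V - {q}" for v using that by blast
    then show "h = h'"
      by (rule PiE_ext[OF burning_functions_PiE[OF h(1)] burning_functions_PiE[OF h(2)]])
  qed
  have class_eq: "?class h = burning_equiv V E q `` {T}" if "T \<in> ?class h" for h T
    using that by (auto simp: burning_equiv_def)
  show "?class ` ?H = rooted_spanning_trees V E q"
  proof (intro equalityI subsetI)
    fix C assume "C \<in> ?class ` ?H"
    then obtain h where h: "h \<in> ?H" "C = ?class h" by blast
    then obtain T where T: "T \<in> ?class h" using spanning_tree_of_burning_function[OF assms h(1)] by blast
    then have "T \<in> inc_spanning_trees V E" by simp
    then show "C \<in> rooted_spanning_trees V E q"
      unfolding rooted_spanning_trees_def h(2) class_eq[OF T] by (rule quotientI)
  next
    fix C assume "C \<in> rooted_spanning_trees V E q"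
    then obtain T where T: "T \<in> inc_spanning_trees V E" "C = burning_equiv V E q `` {T}"
      by (auto simp: rooted_spanning_trees_def elim: quotientE)
    obtain h where h: "h \<in> ?H" "T \<in> ?class h"
      using burning_function_of_spanning_tree[OF assms(2) T(1)] T(1) by blast
    then show "C \<in> ?class ` ?H" using class_eq[OF h(2)] T(2) by blast
  qed
qed

section \<open>Parking functions\<close>

lemma hdeg_antimono:
  assumes "finite E" and "S \<subseteq> T"
  shows "hdeg E T v \<le> hdeg E S v"
  unfolding hdeg_def using assms by (intro card_mono) auto

text \<open>
  Parking functions have no explicit upper bound, but the condition for \<open>T = {v}\<close> bounds the value at
  \<open>v\<close> and so puts it into \<open>{..<hdeg E {} v}\<close>.
\<close>
lemma parking_functions_eq_burning_functions:
  assumes "finite E"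
  shows "parking_functions V E q = burning_functions (V - {q}) (\<lambda>T v. {..<hdeg E T v})"
proof -
  have "c v < hdeg E {} v"
    if "\<forall>T. T \<subseteq> V - {q} \<and> T \<noteq> {} \<longrightarrow> (\<exists>i\<in>T. c i < hdeg E T i)" "v \<in> V - {q}" for c v
  proof -
    have "c v < hdeg E {v} v" using that(1)[rule_format, of "{v}"] that(2) by auto
    also have "\<dots> \<le> hdeg E {} v" using assms by (rule hdeg_antimono) simp
    finally show ?thesis .
  qed
  then show ?thesis
    unfolding parking_functions_def burning_functions_def PiE_iff by blast
qed

theorem theorem4p8:
  fixes V :: "'a set" and E :: "'a set set" and q :: 'a
  assumes "hypergraph V E"
    and "connected_hypergraph V E"
    and "q \<in> V"
  shows "\<exists>f. bij_betw f (parking_functions V E q) (rooted_spanning_trees V E q)"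
proof -
  let ?P = "burning_functions (V - {q}) (\<lambda>T v. {..<hdeg E T v})"
  let ?H = "burning_functions (V - {q}) (crossing E)"
  have "finite V" using assms(1) by (simp add: hypergraph_def)
  moreover have "E \<subseteq> Pow V" using assms(1) by (auto simp: hypergraph_def)
  ultimately have "finite E" using finite_subset by blast
  have "card ?P = card ?H"
  proof (rule card_burning_functions_cong)
    show "{..<hdeg E T v} \<subseteq> {..<hdeg E S v}" if "S \<subseteq> T" for S T v
      using hdeg_antimono[OF \<open>finite E\<close> that] by auto
  qed (use \<open>finite V\<close> \<open>finite E\<close> in \<open>auto simp: hdeg_def\<close>)
  moreover have "finite ?P"
    using \<open>finite V\<close> unfolding burning_functions_def by (simp add: finite_PiE)
  moreover have "finite ?H"
    using \<open>finite V\<close> \<open>finite E\<close> unfolding burning_functions_def by (simp add: finite_PiE)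
  ultimately obtain f where "bij_betw f ?P ?H"
    using finite_same_card_bij by blast
  then show ?thesis
    using bij_betw_trans bij_betw_burning_functions_rooted_spanning_trees[OF assms(1,3)]
    unfolding parking_functions_eq_burning_functions[OF \<open>finite E\<close>] by blast
qed

end
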